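(* Let $G$ be a tree with at least two vertices. Then $G$ is levelable if and only if each non-free vertex of $G$ is adjacent to at least one free vertex of $G$.
   Context: All graphs are finite and simple. A free vertex of a tree is a vertex which belongs to exactly one edge. A graph $G$ on $\{x_1,\ldots,x_n\}$ is levelable if there exist positive integers $c_1,\ldots,c_n$ and a constant $c$ such that $\sum_{x_i\in W}c_i=c$ for every maximal (under inclusion) independent set $W$ of $G$. *)

theory Defs
  imports "Graph_Theory.Graph_Theory"
begin

text \<open>
  A finite simple graph is a digraph satisfying \<^locale>\<open>pair_graph\<close>: the vertex set and the arc
  relation are finite, and the arc relation is symmetric and irreflexive. An undirected edge
  \<open>{u, v}\<close> is thus represented by the two arcs \<open>(u, v)\<close> and \<open>(v, u)\<close>.
\<close>

definition edges :: "'a pair_pre_digraph \<Rightarrow> 'a set set" where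
  "edges G = {{u, v} | u v. (u, v) \<in> parcs G}"

lemma (in pair_graph) in_edges_iff: "{u, v} \<in> edges G \<longleftrightarrow> (u, v) \<in> parcs G"
  using pair_sym_arcs by (auto simp: edges_def symmetric_def doubleton_eq_iff dest: symD)

text \<open>
  The library predicate \<^const>\<open>tree\<close> is not suitable for symmetric digraphs: there the closed
  walk \<open>u, v, u\<close> along the two arcs of one edge counts as a \<^const>\<open>pre_digraph.cycle\<close>. In a
  \<^locale>\<open>pair_graph\<close>, the cycles of the undirected graph are exactly those of length at least 3.
\<close>

definition undirected_tree :: "'a pair_pre_digraph \<Rightarrow> bool" where
  "undirected_tree G \<longleftrightarrow> pair_graph G \<and> Digraph_Component.connected (with_proj G) \<and>
     \<not> (\<exists>p. pre_digraph.cycle (with_proj G) p \<and> length p \<ge> 3)"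

definition free_vertex :: "'a pair_pre_digraph \<Rightarrow> 'a \<Rightarrow> bool" where
  "free_vertex G v \<longleftrightarrow> v \<in> pverts G \<and> (\<exists>!e. e \<in> edges G \<and> v \<in> e)"

definition independent_set :: "'a pair_pre_digraph \<Rightarrow> 'a set \<Rightarrow> bool" where
  "independent_set G W \<longleftrightarrow> W \<subseteq> pverts G \<and> (\<forall>u\<in>W. \<forall>v\<in>W. {u, v} \<notin> edges G)"

definition maximal_independent_set :: "'a pair_pre_digraph \<Rightarrow> 'a set \<Rightarrow> bool" where
  "maximal_independent_set G W \<longleftrightarrow>
     independent_set G W \<and> (\<forall>W'. independent_set G W' \<and> W \<subseteq> W' \<longrightarrow> W' = W)"

definition levelable :: "'a pair_pre_digraph \<Rightarrow> bool" where
  "levelable G \<longleftrightarrow> (\<exists>(c :: 'a \<Rightarrow> nat) d. (\<forall>v\<in>pverts G. c v > 0) \<and>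
     (\<forall>W. maximal_independent_set G W \<longrightarrow> (\<Sum>v\<in>W. c v) = d))"

end

theory Submission
  imports Defs
begin

text \<open>
  A single edge is levelable with weights 1. Otherwise no two free vertices are adjacent. If every
  non-free vertex has a free neighbour, give each free vertex weight 1 and each non-free
  vertex the number of its free neighbours: a maximal independent set contains, for every non-free
  vertex, either this vertex or all of its free neighbours, so its weight is the number of free
  vertices.

  Conversely, suppose that distinct neighbours \<open>a\<close>, \<open>b\<close> of a vertex \<open>r\<close> have no free neighbour other
  than possibly \<open>r\<close>, and that \<open>a\<close> has another neighbour \<open>w\<close>. On the branch of the tree at \<open>a\<close>
  beyond \<open>r\<close> one can choose a maximal independent set \<open>P\<close> of the branch without \<open>a\<close> that does not
  dominate \<open>a\<close>, and another one \<open>P'\<close> that contains \<open>w\<close>; off the branch one can choose \<open>Q\<close> that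
  dominates neither \<open>r\<close> nor \<open>b\<close>. Completing with \<open>r\<close> shows that \<open>P\<close> and \<open>P'\<close> have the same weight;
  completing with the undominated neighbours of \<open>r\<close>, which include \<open>a\<close> for \<open>P\<close> but not for \<open>P'\<close>, then
  gives \<open>a\<close> weight 0. If \<open>v\<close> is non-free without a free neighbour, this situation occurs either at
  \<open>r = v\<close>, or at a neighbour \<open>r\<close> of \<open>v\<close> with a free neighbour \<open>b\<close>, with \<open>a = v\<close>.
\<close>

section \<open>Free vertices and maximal independent sets via neighbours\<close>

context pair_graph
begin

lemma free_vertex_iff: "free_vertex G v \<longleftrightarrow> (\<exists>!w. (v, w) \<in> parcs G)"
proof -
  have incident: "e \<in> edges G \<and> v \<in> e \<longleftrightarrow> (\<exists>w. (v, w) \<in> parcs G \<and> e = {v, w})" for e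
    by (auto simp: edges_def doubleton_eq_iff dest: arcs_symmetric)
  have "(\<exists>!e. \<exists>w. (v, w) \<in> parcs G \<and> e = {v, w}) \<longleftrightarrow> (\<exists>!w. (v, w) \<in> parcs G)"
  proof
    assume ex1: "\<exists>!e. \<exists>w. (v, w) \<in> parcs G \<and> e = {v, w}"
    then obtain w where w: "(v, w) \<in> parcs G"
      by blast
    have "w' = w" if "(v, w') \<in> parcs G" for w'
    proof -
      have "{v, w'} = {v, w}"
        using ex1 w that by blast
      then show ?thesis
        by (auto simp: doubleton_eq_iff)
    qed
    with w show "\<exists>!w. (v, w) \<in> parcs G"
      by blast
  qed blast
  then show ?thesis
    unfolding free_vertex_def incident by (auto dest: in_arcsD1)
qed

lemma non_free_other_neighbour:
  assumes "\<not> free_vertex G v" "(v, w) \<in> parcs G"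
  obtains w' where "w' \<noteq> w" "(v, w') \<in> parcs G"
  using assms unfolding free_vertex_iff by metis

lemma independent_set_iff:
  "independent_set G W \<longleftrightarrow> W \<subseteq> pverts G \<and> (\<forall>u\<in>W. \<forall>v\<in>W. (u, v) \<notin> parcs G)"
  by (simp add: independent_set_def in_edges_iff)

lemma independent_set_Un:
  assumes "independent_set G A" "independent_set G B" "\<And>u v. u \<in> A \<Longrightarrow> v \<in> B \<Longrightarrow> (u, v) \<notin> parcs G"
  shows "independent_set G (A \<union> B)"
  using assms by (auto simp: independent_set_iff dest: arcs_symmetric)

text \<open>An undominated vertex could be inserted without losing independence. This local form of
  maximality can be checked vertex by vertex when sets are glued from pieces.\<close>

lemma maximal_independent_set_iff:
  "maximal_independent_set G W \<longleftrightarrow>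
     independent_set G W \<and> (\<forall>v\<in>pverts G - W. \<exists>w\<in>W. (v, w) \<in> parcs G)"
proof (intro iffI conjI)
  assume W: "maximal_independent_set G W"
  then show "independent_set G W"
    by (simp add: maximal_independent_set_def)
  show "\<forall>v\<in>pverts G - W. \<exists>w\<in>W. (v, w) \<in> parcs G"
  proof (rule ccontr)
    assume "\<not> ?thesis"
    then obtain v where v: "v \<in> pverts G" "v \<notin> W" "\<forall>w\<in>W. (v, w) \<notin> parcs G"
      by blast
    then have "independent_set G (insert v W)"
      using \<open>independent_set G W\<close> no_loops'
      by (auto simp: independent_set_iff dest: arcs_symmetric)
    with W v(2) show False
      unfolding maximal_independent_set_def by blast
  qed
next
  assume "independent_set G W \<and> (\<forall>v\<in>pverts G - W. \<exists>w\<in>W. (v, w) \<in> parcs G)"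
  then show "maximal_independent_set G W"
    unfolding maximal_independent_set_def independent_set_iff by blast
qed

text \<open>Take a maximal element of the finite family of independent sets between \<open>I\<close>
  and \<open>Y\<close>. Since \<open>P\<close> is maximal only relative to \<open>Y\<close>, pieces
  built on different parts of the graph can be combined later.\<close>

lemma extend_independent_set:
  assumes "independent_set G I" "I \<subseteq> Y" "Y \<subseteq> pverts G"
  obtains P where "I \<subseteq> P" "P \<subseteq> Y" "independent_set G P" "\<forall>y\<in>Y - P. \<exists>p\<in>P. (y, p) \<in> parcs G"
proof -
  let ?S = "{P. I \<subseteq> P \<and> P \<subseteq> Y \<and> independent_set G P}"
  have "finite Y"
    using assms(3) pair_finite_verts by (rule finite_subset)
  then have "finite ?S"
    by simp
  moreover have "I \<in> ?S"
    using assms by simp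
  ultimately have "\<exists>P\<in>?S. \<forall>P'\<in>?S. P \<subseteq> P' \<longrightarrow> P = P'"
    by (intro finite_has_maximal) auto
  then obtain P where P: "P \<in> ?S" and max: "\<And>P'. P' \<in> ?S \<Longrightarrow> P \<subseteq> P' \<Longrightarrow> P = P'"
    by meson
  have "\<exists>p\<in>P. (y, p) \<in> parcs G" if y: "y \<in> Y - P" for y
  proof (rule ccontr)
    assume "\<not> ?thesis"
    then have "insert y P \<in> ?S"
      using P y assms(3) no_loops' by (auto simp: independent_set_iff dest: arcs_symmetric)
    then show False
      using max y by blast
  qed
  with P that show ?thesis
    by blast
qed

end

section \<open>Trees and the branches obtained by deleting an edge\<close>

definition branch :: "'a pair_pre_digraph \<Rightarrow> 'a \<Rightarrow> 'a \<Rightarrow> 'a set" where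
  "branch G x y = {z. (x, z) \<in> (parcs G - {(x, y), (y, x)})\<^sup>*}"

locale undirected_tree_graph = pair_graph +
  assumes connected: "Digraph_Component.connected (with_proj G)"
    and no_long_cycle: "\<nexists>p. cycle p \<and> length p \<ge> 3"
begin

lemma connected_rtrancl:
  assumes "u \<in> pverts G" "v \<in> pverts G"
  shows "(u, v) \<in> (parcs G)\<^sup>*"
proof -
  have "u \<rightarrow>\<^sup>*\<^bsub>mk_symmetric (with_proj G)\<^esub> v"
    using connected assms by (auto simp: connected_def strongly_connected_def)
  then have "u \<rightarrow>\<^sup>*\<^bsub>with_proj G\<^esub> v"
    using reachable_mk_symmetric_eq[OF pair_sym_arcs] by simp
  then show ?thesis
    using reachable_rtranclI by force
qed

lemma has_neighbour:
  assumes "card (pverts G) \<ge> 2" "v \<in> pverts G"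
  obtains w where "(v, w) \<in> parcs G"
proof -
  have "\<not> pverts G \<subseteq> {v}"
    using assms(1) card_mono[of "{v}" "pverts G"] by auto
  then obtain u where "u \<in> pverts G" "u \<noteq> v"
    by blast
  then show ?thesis
    using connected_rtrancl[OF assms(2)] that by (metis converse_rtranclE)
qed

lemma root_in_branch: "x \<in> branch G x y"
  by (simp add: branch_def)

lemma branch_step:
  assumes "p \<in> branch G x y" "(p, q) \<in> parcs G" "(p, q) \<noteq> (x, y)" "(p, q) \<noteq> (y, x)"
  shows "q \<in> branch G x y"
  using assms unfolding branch_def by (auto intro: rtrancl.rtrancl_into_rtrancl)

lemma branch_subset_verts:
  assumes "(x, y) \<in> parcs G"
  shows "branch G x y \<subseteq> pverts G"
proof
  fix z assume "z \<in> branch G x y"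
  then have "(x, z) \<in> (parcs G - {(x, y), (y, x)})\<^sup>*"
    by (simp add: branch_def)
  then show "z \<in> pverts G"
    using assms by (induction rule: rtrancl_induct) (auto dest: in_arcsD1 in_arcsD2)
qed

text \<open>Acyclicity enters here: a simple path from \<open>x\<close> to \<open>y\<close> that
  avoids their edge is closed by the arc \<open>(y, x)\<close> to a forbidden cycle.\<close>

lemma not_in_branch:
  assumes "(x, y) \<in> parcs G"
  shows "y \<notin> branch G x y"
proof
  assume "y \<in> branch G x y"
  define H where "H = \<lparr>pverts = pverts G, parcs = parcs G - {(x, y), (y, x)}\<rparr>"
  interpret H: pair_wf_digraph H
    by unfold_locales (auto simp: H_def dest: in_arcsD1 in_arcsD2)
  have "(x, y) \<in> (parcs H)\<^sup>*"
    using \<open>y \<in> branch G x y\<close> by (simp add: branch_def H_def)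
  then have "x \<rightarrow>\<^sup>*\<^bsub>with_proj H\<^esub> y"
  proof (induction rule: rtrancl_induct)
    case base
    then show ?case
      using in_arcsD1[OF assms] by (intro H.reachable_refl) (simp add: H_def)
  next
    case (step y z)
    then show ?case
      by (auto intro: H.reachable_adj_trans)
  qed
  then obtain p where p: "H.apath x p y"
    using H.reachable_apath by blast
  have "set p \<subseteq> parcs G" "(x, y) \<notin> set p" "pcas x p y" "distinct (pawalk_verts x p)"
    using p unfolding H.apath_def H.awalk_def by (auto simp: H_def)
  moreover have "x \<noteq> y"
    using assms no_loops' by blast
  \<comment> \<open>The path is nonempty because \<open>x\<close> and \<open>y\<close> differ, and
    it is not the single arc \<open>(x, y)\<close> because that arc was deleted.\<close>
  ultimately have "length p \<ge> 2"
    by (cases p; cases "tl p") auto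
  moreover have "cycle ((y, x) # p)"
    unfolding cycle_def awalk_def
    using \<open>set p \<subseteq> parcs G\<close> \<open>pcas x p y\<close> \<open>distinct (pawalk_verts x p)\<close> arcs_symmetric[OF assms] in_arcsD2[OF assms]
    by auto
  ultimately show False
    using no_long_cycle by force
qed

text \<open>By \<open>branch_step\<close>, an arc leaving the branch is one of the two deleted arcs,
  and \<open>(y, x)\<close> starts outside the branch.\<close>

lemma branch_exit:
  assumes "(x, y) \<in> parcs G" "p \<in> branch G x y" "(p, q) \<in> parcs G" "q \<notin> branch G x y"
  shows "p = x" "q = y"
  using assms branch_step[of p x y q] not_in_branch[of x y] by auto

lemma branch_enter:
  assumes "(x, y) \<in> parcs G" "p \<in> branch G x y" "(q, p) \<in> parcs G" "q \<notin> branch G x y"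
  shows "p = x" "q = y"
  using branch_exit[OF assms(1,2) _ assms(4)] arcs_symmetric[OF assms(3)] by auto

lemma neighbour_not_in_branch:
  assumes "(x, y) \<in> parcs G" "(z, y) \<in> parcs G" "z \<noteq> x"
  shows "z \<notin> branch G x y"
  using branch_exit(1)[OF assms(1) _ assms(2) not_in_branch[OF assms(1)]] assms(3) by blast

text \<open>Excludes triangles: the arc \<open>(x, z)\<close> would leave the branch of
  \<open>x\<close> away from \<open>y\<close>, forcing \<open>z = y\<close>.\<close>

lemma neighbours_not_adjacent:
  assumes "(x, y) \<in> parcs G" "(z, y) \<in> parcs G"
  shows "(x, z) \<notin> parcs G"
proof
  assume "(x, z) \<in> parcs G"
  moreover from this have "z \<noteq> x"
    using no_loops' by blast
  ultimately have "z = y"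
    using branch_exit(2)[OF assms(1) root_in_branch] neighbour_not_in_branch[OF assms] by blast
  then show False
    using assms(2) no_loops' by blast
qed

text \<open>A path inside the branch at \<open>b\<close> starts outside the branch at
  \<open>a\<close> and could enter it only from \<open>r\<close>, which it never visits.\<close>

lemma branches_disjoint:
  assumes "(a, r) \<in> parcs G" "(b, r) \<in> parcs G" "a \<noteq> b"
  shows "branch G a r \<inter> branch G b r = {}"
proof -
  have "z \<notin> branch G a r" if "z \<in> branch G b r" for z
  proof -
    have "(b, z) \<in> (parcs G - {(b, r), (r, b)})\<^sup>*"
      using that by (simp add: branch_def)
    then have "z \<in> branch G b r \<and> z \<notin> branch G a r"
    proof (induction rule: rtrancl_induct)
      case base
      then show ?case
        using neighbour_not_in_branch[OF assms(1,2)] assms(3) root_in_branch by auto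
    next
      case (step y z)
      then have "z \<in> branch G b r"
        using branch_step by auto
      moreover have "y \<noteq> r"
        using step not_in_branch[OF assms(2)] by blast
      ultimately show ?case
        using step branch_enter(2)[OF assms(1), of z y] by blast
    qed
    then show ?thesis ..
  qed
  then show ?thesis
    by blast
qed

section \<open>Necessity: exchanging independent sets on a branch\<close>

text \<open>Each neighbour of \<open>b\<close> other than \<open>r\<close> is non-free, so a further
  neighbour of it can be chosen; \<open>X\<close> collects these choices. Any independent set
  containing \<open>X\<close> then avoids all neighbours of \<open>b\<close> except possibly
  \<open>r\<close>.\<close>

lemma dominate_second_neighbours:
  assumes br: "(b, r) \<in> parcs G"
    and non_free: "\<And>w. (b, w) \<in> parcs G \<Longrightarrow> w \<noteq> r \<Longrightarrow> \<not> free_vertex G w"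
  obtains X where "X \<subseteq> branch G b r - {b}" "independent_set G X" "\<forall>x\<in>X. (b, x) \<notin> parcs G"
    "\<forall>w. (b, w) \<in> parcs G \<longrightarrow> w \<noteq> r \<longrightarrow> (\<exists>x\<in>X. (w, x) \<in> parcs G)"
proof -
  define N where "N = {w. (b, w) \<in> parcs G \<and> w \<noteq> r}"
  have "\<exists>x. x \<noteq> b \<and> (w, x) \<in> parcs G" if "w \<in> N" for w
  proof -
    have "\<not> free_vertex G w" "(w, b) \<in> parcs G"
      using that non_free arcs_symmetric by (auto simp: N_def)
    then show ?thesis
      using non_free_other_neighbour by blast
  qed
  then obtain f where f: "\<And>w. w \<in> N \<Longrightarrow> f w \<noteq> b \<and> (w, f w) \<in> parcs G"
    by metis
  have N_branch: "w \<in> branch G b r" if "w \<in> N" for w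
    using that branch_step[OF root_in_branch, of b w r] no_loops' br by (auto simp: N_def)
  have f_branch: "f w \<in> branch G b r" if "w \<in> N" for w
    using that f[OF that] branch_step[OF N_branch[OF that], of "f w"] no_loops' by (auto simp: N_def)
  have f_not_adj: "(b, f w) \<notin> parcs G" if "w \<in> N" for w
  proof
    assume *: "(b, f w) \<in> parcs G"
    have "(w, b) \<in> parcs G"
      using that arcs_symmetric by (auto simp: N_def)
    then show False
      using neighbours_not_adjacent[of w b "f w"] arcs_symmetric[OF *] f[OF that] by blast
  qed
  \<comment> \<open>For distinct \<open>w\<close> and \<open>w'\<close> the choices lie in disjoint
    branches at \<open>b\<close>. An arc out of such a branch ends at \<open>b\<close>, which is
    never chosen.\<close>
  have "(f w, f w') \<notin> parcs G" if w: "w \<in> N" and w': "w' \<in> N" for w w'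
  proof (cases "w = w'")
    case True
    then show ?thesis
      using no_loops' by blast
  next
    case False
    have wb: "(w, b) \<in> parcs G" "(w', b) \<in> parcs G"
      using w w' arcs_symmetric by (auto simp: N_def)
    have in_branch: "f u \<in> branch G u b" if "u \<in> N" "(u, b) \<in> parcs G" for u
      using branch_step[OF root_in_branch, of u "f u" b] f[OF that(1)] that no_loops' by auto
    have "f w' \<notin> branch G w b"
      using branches_disjoint[OF wb False] in_branch[OF w' wb(2)] by blast
    then show ?thesis
      using branch_exit(2)[OF wb(1) in_branch[OF w wb(1)]] f[OF w'] by blast
  qed
  then have "independent_set G (f ` N)"
    using f_branch branch_subset_verts[OF br] unfolding independent_set_iff by blast
  moreover have "f ` N \<subseteq> branch G b r - {b}" "\<forall>x\<in>f ` N. (b, x) \<notin> parcs G"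
    using f f_branch f_not_adj by blast+
  moreover have "\<forall>w. (b, w) \<in> parcs G \<longrightarrow> w \<noteq> r \<longrightarrow> (\<exists>x\<in>f ` N. (w, x) \<in> parcs G)"
    using f unfolding N_def by blast
  ultimately show ?thesis
    using that by metis
qed

text \<open>The roles differ: \<open>a\<close> is the vertex whose weight is forced to 0, while
  \<open>b\<close> dominates \<open>r\<close> when both \<open>a\<close> and \<open>r\<close> are
  left out. Hence \<open>b\<close> may be free, in which case the last hypothesis is
  vacuous.\<close>

lemma not_levelable_if_two_neighbours:
  assumes ar: "(a, r) \<in> parcs G" and br: "(b, r) \<in> parcs G" and "a \<noteq> b"
    and a_non_free: "\<not> free_vertex G a"
    and na: "\<And>w. (a, w) \<in> parcs G \<Longrightarrow> w \<noteq> r \<Longrightarrow> \<not> free_vertex G w"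
    and nb: "\<And>w. (b, w) \<in> parcs G \<Longrightarrow> w \<noteq> r \<Longrightarrow> \<not> free_vertex G w"
  shows "\<not> levelable G"
proof
  assume "levelable G"
  then obtain c :: "'a \<Rightarrow> nat" and d where pos: "\<And>v. v \<in> pverts G \<Longrightarrow> c v > 0"
    and lev: "\<And>W. maximal_independent_set G W \<Longrightarrow> sum c W = d"
    unfolding levelable_def by blast
  define T where "T = branch G a r"
  \<comment> \<open>Removing \<open>r\<close> and all its neighbours lets a set chosen in
    \<open>Y\<close> be completed either by \<open>r\<close> or by neighbours of
    \<open>r\<close>.\<close>
  define Y where "Y = pverts G - T - insert r {u. (u, r) \<in> parcs G}"
  note sym = arcs_symmetric
  have aT: "a \<in> T" and rT: "r \<notin> T" and TV: "T \<subseteq> pverts G"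
    using root_in_branch not_in_branch[OF ar] branch_subset_verts[OF ar] by (auto simp: T_def)
  have cross: "p = a \<and> q = r" if "p \<in> T" "(p, q) \<in> parcs G" "q \<notin> T" for p q
    using that branch_exit[OF ar] by (auto simp: T_def)
  have nT: "u \<notin> T" if "(u, r) \<in> parcs G" "u \<noteq> a" for u
    using neighbour_not_in_branch[OF ar that] by (simp add: T_def)
  obtain w where w: "(a, w) \<in> parcs G" "w \<noteq> r"
    using non_free_other_neighbour[OF a_non_free ar] by blast
  have wT: "w \<in> T" "w \<noteq> a"
    using cross[OF aT] w no_loops' by blast+
  \<comment> \<open>\<open>A\<close> will keep \<open>P\<close> from dominating \<open>a\<close>;
    likewise \<open>B\<close> will keep \<open>Q\<close> from dominating \<open>b\<close>.\<close>
  obtain A where A: "A \<subseteq> T - {a}" "independent_set G A" "\<forall>x\<in>A. (a, x) \<notin> parcs G"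
    "\<forall>w. (a, w) \<in> parcs G \<longrightarrow> w \<noteq> r \<longrightarrow> (\<exists>x\<in>A. (w, x) \<in> parcs G)"
    using dominate_second_neighbours[OF ar na] unfolding T_def by metis
  obtain B where B: "B \<subseteq> branch G b r - {b}" "independent_set G B" "\<forall>x\<in>B. (b, x) \<notin> parcs G"
    "\<forall>w. (b, w) \<in> parcs G \<longrightarrow> w \<noteq> r \<longrightarrow> (\<exists>x\<in>B. (w, x) \<in> parcs G)"
    using dominate_second_neighbours[OF br nb] by metis
  obtain P where P: "A \<subseteq> P" "P \<subseteq> T - {a}" "independent_set G P"
    "\<forall>y\<in>T - {a} - P. \<exists>p\<in>P. (y, p) \<in> parcs G"
    using extend_independent_set[OF A(2,1)] TV by blast
  have "independent_set G {w}"
    using w in_arcsD2 no_loops' by (auto simp: independent_set_iff)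
  then obtain P' where P': "{w} \<subseteq> P'" "P' \<subseteq> T - {a}" "independent_set G P'"
    "\<forall>y\<in>T - {a} - P'. \<exists>p\<in>P'. (y, p) \<in> parcs G"
    using extend_independent_set[of "{w}" "T - {a}"] wT TV by blast
  have "B \<subseteq> Y"
  proof
    fix x assume "x \<in> B"
    then have x: "x \<in> branch G b r" "x \<noteq> b"
      using B(1) by auto
    then have "(x, r) \<notin> parcs G" "x \<noteq> r"
      using branch_exit(1)[OF br _ _ not_in_branch[OF br]] not_in_branch[OF br] by auto
    moreover have "x \<notin> T"
      using branches_disjoint[OF ar br \<open>a \<noteq> b\<close>] x(1) by (auto simp: T_def)
    ultimately show "x \<in> Y"
      using x branch_subset_verts[OF br] by (auto simp: Y_def)
  qed
  then obtain Q where Q: "B \<subseteq> Q" "Q \<subseteq> Y" "independent_set G Q"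
    "\<forall>y\<in>Y - Q. \<exists>p\<in>Q. (y, p) \<in> parcs G"
    using extend_independent_set[OF B(2)] Y_def by blast
  \<comment> \<open>These are the vertices to add when \<open>r\<close> is omitted. Having the
    common neighbour \<open>r\<close>, they are pairwise non-adjacent.\<close>
  define U where "U = {u. (u, r) \<in> parcs G \<and> u \<noteq> a \<and> (\<forall>q\<in>Q. (u, q) \<notin> parcs G)}"
  have aP: "(a, p) \<notin> parcs G" if "p \<in> P" for p
  proof
    assume "(a, p) \<in> parcs G"
    moreover have "p \<noteq> r"
      using that P(2) rT by blast
    ultimately obtain x where "x \<in> A" "(p, x) \<in> parcs G"
      using A(4) by blast
    then show False
      using P(1,3) that by (auto simp: independent_set_iff)
  qed
  have bQ: "(b, q) \<notin> parcs G" if "q \<in> Q" for q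
  proof
    assume "(b, q) \<in> parcs G"
    moreover have "q \<noteq> r"
      using that Q(2) by (auto simp: Y_def)
    ultimately obtain x where "x \<in> B" "(q, x) \<in> parcs G"
      using B(4) by blast
    then show False
      using Q(1,3) that by (auto simp: independent_set_iff)
  qed
  have bU: "b \<in> U"
    using br bQ \<open>a \<noteq> b\<close> by (auto simp: U_def)
  have ST: "p \<in> pverts G" "p \<in> T" "p \<noteq> a" if "p \<in> S" "S \<subseteq> T - {a}" for p S
    using that TV by auto
  have QT: "q \<noteq> r" "q \<notin> T" "(q, r) \<notin> parcs G" "(r, q) \<notin> parcs G" if "q \<in> Q" for q
    using that Q(2) sym by (auto simp: Y_def)
  have UT: "u \<notin> T" "u \<noteq> a" "(u, r) \<in> parcs G" if "u \<in> U" for u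
    using that nT by (auto simp: U_def)
  have TQ: "(p, q) \<notin> parcs G" if "p \<in> T" "q \<in> Q" for p q
    using cross[OF that(1)] QT[OF that(2)] by blast
  have TU: "(p, u) \<notin> parcs G" if "p \<in> T" "u \<in> U" for p u
    using cross[OF that(1)] UT[OF that(2)] no_loops' by blast
  have ind_r: "independent_set G {r}"
    using in_arcsD2[OF ar] no_loops' by (auto simp: independent_set_iff)
  have ind_a: "independent_set G {a}"
    using in_arcsD1[OF ar] no_loops' by (auto simp: independent_set_iff)
  have ind_U: "independent_set G U"
    unfolding independent_set_iff using UT(3) in_arcsD1 neighbours_not_adjacent by blast
  have ind_Q: "independent_set G (S \<union> Q)" if "S \<subseteq> T - {a}" "independent_set G S" for S
    using that TQ Q(3) ST(2) by (intro independent_set_Un) blast+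
  have ind_QU: "independent_set G (S \<union> Q \<union> U)" if S: "S \<subseteq> T - {a}" "independent_set G S" for S
  proof (rule independent_set_Un[OF ind_Q[OF S] ind_U])
    fix p u assume "p \<in> S \<union> Q" "u \<in> U"
    then show "(p, u) \<notin> parcs G"
      using TU ST(2)[OF _ S(1)] sym by (auto simp: U_def)
  qed
  \<comment> \<open>Stated for an arbitrary \<open>S\<close> so as to serve both \<open>P\<close>
    and \<open>P'\<close>.\<close>
  have dom: "(v, r) \<in> parcs G \<or> v = r \<or> (\<exists>p\<in>S \<union> Q. (v, p) \<in> parcs G)"
    if "v \<in> pverts G" "v \<notin> S \<union> Q" "\<forall>y\<in>T - {a} - S. \<exists>p\<in>S. (y, p) \<in> parcs G" for v S
    using that Q(4) ar by (cases "v \<in> T"; cases "v = a") (auto simp: Y_def)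
  have dom_U: "v = a \<or> v = r \<or> v \<in> U \<or> (\<exists>p\<in>S \<union> Q. (v, p) \<in> parcs G)"
    if "v \<in> pverts G" "v \<notin> S \<union> Q" "\<forall>y\<in>T - {a} - S. \<exists>p\<in>S. (y, p) \<in> parcs G" for v S
    using dom[OF that] by (auto simp: U_def)
  have max_r: "maximal_independent_set G (S \<union> Q \<union> {r})"
    if S: "S \<subseteq> T - {a}" "independent_set G S" "\<forall>y\<in>T - {a} - S. \<exists>p\<in>S. (y, p) \<in> parcs G" for S
  proof -
    have "(p, r) \<notin> parcs G" if "p \<in> S \<union> Q" for p
      using that cross ST[OF _ S(1)] QT rT by blast
    then have "independent_set G (S \<union> Q \<union> {r})"
      by (intro independent_set_Un ind_Q S ind_r) auto
    then show ?thesis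
      using dom[OF _ _ S(3)] by (auto simp: maximal_independent_set_iff)
  qed
  \<comment> \<open>Here \<open>a\<close> is dominated by \<open>w\<close> in \<open>P'\<close>, and
    \<open>r\<close> by \<open>b\<close> in \<open>U\<close>.\<close>
  have max_U: "maximal_independent_set G (P' \<union> Q \<union> U)"
    using ind_QU[OF P'(2,3)] dom_U[OF _ _ P'(4)] P'(1) w(1) bU sym[OF br]
    by (auto simp: maximal_independent_set_iff)
  \<comment> \<open>With \<open>P\<close> in place of \<open>P'\<close> nothing dominates
    \<open>a\<close>, so \<open>a\<close> itself must be added; it then dominates
    \<open>r\<close>.\<close>
  have "(p, a) \<notin> parcs G" if "p \<in> P \<union> Q \<union> U" for p
    using that aP TQ[OF aT] TU[OF aT] sym by blast
  then have "independent_set G (P \<union> Q \<union> U \<union> {a})"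
    by (intro independent_set_Un ind_QU P ind_a) auto
  then have max_aU: "maximal_independent_set G (P \<union> Q \<union> U \<union> {a})"
    using dom_U[OF _ _ P(4)] sym[OF ar] by (auto simp: maximal_independent_set_iff)
  have fin: "finite S" if "independent_set G S" for S
    using that pair_finite_verts by (auto simp: independent_set_iff intro: finite_subset)
  have sum_Q: "sum c (S \<union> Q) = sum c S + sum c Q"
    if "S \<subseteq> T - {a}" "independent_set G S" for S
    using that(1) QT(2) by (intro sum.union_disjoint fin that(2) Q(3)) blast
  have sum_r: "sum c (S \<union> Q \<union> {r}) = sum c S + sum c Q + c r"
    if S: "S \<subseteq> T - {a}" "independent_set G S" for S
  proof -
    have "r \<notin> S \<union> Q"
      using S rT QT by blast
    then show ?thesis
      using fin[OF ind_Q[OF S]] sum_Q[OF S] by simp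
  qed
  have sum_U: "sum c (S \<union> Q \<union> U) = sum c S + sum c Q + sum c U"
    if S: "S \<subseteq> T - {a}" "independent_set G S" for S
  proof -
    have "(S \<union> Q) \<inter> U = {}"
      using ST[OF _ S(1)] QT UT by blast
    then show ?thesis
      using fin[OF ind_Q[OF S]] fin[OF ind_U] sum_Q[OF S] by (simp add: sum.union_disjoint)
  qed
  have "a \<notin> P \<union> Q \<union> U"
    using P(2) QT UT aT by blast
  then have "sum c (P \<union> Q \<union> U \<union> {a}) = sum c P + sum c Q + sum c U + c a"
    using fin[OF ind_QU[OF P(2,3)]] sum_U[OF P(2,3)] by simp
  \<comment> \<open>Both sets completed by \<open>Q\<close> and \<open>r\<close> have weight
    \<open>d\<close>, and the common terms cancel.\<close>
  moreover have "sum c P = sum c P'"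
    using lev[OF max_r[OF P(2-4)]] lev[OF max_r[OF P'(2-4)]] sum_r[OF P(2,3)] sum_r[OF P'(2,3)]
    by simp
  ultimately have "c a = 0"
    using lev[OF max_U] lev[OF max_aU] sum_U[OF P'(2,3)] by simp
  then show False
    using pos in_arcsD1[OF ar] by force
qed

lemma levelable_imp_free_neighbour:
  assumes "card (pverts G) \<ge> 2" "levelable G" "v \<in> pverts G" "\<not> free_vertex G v"
  shows "\<exists>w. free_vertex G w \<and> (v, w) \<in> parcs G"
proof (rule ccontr)
  assume "\<not> ?thesis"
  then have no_free: "\<not> free_vertex G w" if "(v, w) \<in> parcs G" for w
    using that by blast
  obtain u where u: "(v, u) \<in> parcs G"
    using has_neighbour assms(1,3) by blast
  obtain u' where u': "u' \<noteq> u" "(v, u') \<in> parcs G"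
    using non_free_other_neighbour[OF assms(4) u] by blast
  show False
  proof (cases "\<exists>r b. (v, r) \<in> parcs G \<and> (r, b) \<in> parcs G \<and> free_vertex G b")
    case True
    then obtain r b where rb: "(v, r) \<in> parcs G" "(b, r) \<in> parcs G" "free_vertex G b"
      using arcs_symmetric by blast
    have "v \<noteq> b"
      using rb(3) assms(4) by blast
    \<comment> \<open>The condition on the neighbours of \<open>b\<close> other than
      \<open>r\<close> thus becomes vacuous.\<close>
    have leaf: "w = r" if "(b, w) \<in> parcs G" for w
      using that rb(2,3) by (auto simp: free_vertex_iff)
    have "\<not> levelable G"
      using rb(1,2) \<open>v \<noteq> b\<close> assms(4)
      by (rule not_levelable_if_two_neighbours) (use leaf no_free in blast)+
    then show False
      using assms(2) by contradiction
  next
    case False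
    \<comment> \<open>No vertex at the end of a walk of length two from \<open>v\<close> is free, so
      \<open>u\<close> and \<open>u'\<close> serve as the two neighbours of
      \<open>r = v\<close>.\<close>
    then have second: "\<not> free_vertex G w" if "(v, x) \<in> parcs G" "(x, w) \<in> parcs G" for x w
      using that by blast
    have "\<not> levelable G"
      using arcs_symmetric[OF u] arcs_symmetric[OF u'(2)] u'(1)[symmetric] no_free[OF u]
      by (rule not_levelable_if_two_neighbours) (use second u u'(2) in blast)+
    then show False
      using assms(2) by contradiction
  qed
qed

section \<open>Sufficiency: explicit weights\<close>

lemma free_neighbours_imp_levelable:
  assumes free_nb: "\<And>v. v \<in> pverts G \<Longrightarrow> \<not> free_vertex G v \<Longrightarrow> \<exists>w. free_vertex G w \<and> (v, w) \<in> parcs G"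
  shows "levelable G"
proof (cases "\<exists>u v. free_vertex G u \<and> free_vertex G v \<and> (u, v) \<in> parcs G")
  case True
  then obtain u v where uv: "free_vertex G u" "free_vertex G v" "(u, v) \<in> parcs G"
    by blast
  have vu: "(v, u) \<in> parcs G"
    using uv(3) by (rule arcs_symmetric)
  have nb: "y = v" if "(u, y) \<in> parcs G" for y
    using that uv(1,3) unfolding free_vertex_iff by blast
  have nb': "y = u" if "(v, y) \<in> parcs G" for y
    using that uv(2) vu unfolding free_vertex_iff by blast
  \<comment> \<open>By connectedness, two adjacent free vertices make up the whole tree.\<close>
  have "z \<in> {u, v}" if "z \<in> pverts G" for z
    using connected_rtrancl[OF in_arcsD1[OF uv(3)] that]
    by (induction rule: rtrancl_induct) (use nb nb' in blast)+
  then have V: "pverts G = {u, v}"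
    using in_arcsD1[OF uv(3)] in_arcsD2[OF uv(3)] by (intro equalityI subsetI) auto
  have "sum (\<lambda>_. 1) W = (1 :: nat)" if "maximal_independent_set G W" for W
  proof -
    have "W \<subseteq> {u, v}" "\<not> {u, v} \<subseteq> W" "W \<noteq> {}"
      using that uv(3) V by (auto simp: maximal_independent_set_iff independent_set_iff)
    then have "W = {u} \<or> W = {v}"
      by auto
    then show ?thesis
      by auto
  qed
  then show ?thesis
    unfolding levelable_def by (intro exI[of _ "\<lambda>_. 1"] exI[of _ 1]) auto
next
  case False
  define L where "L v = {w. free_vertex G w \<and> (v, w) \<in> parcs G}" for v
  define F where "F = {w \<in> pverts G. free_vertex G w}"
  define c where "c v = (if free_vertex G v then 1 else card (L v))" for v
  have "F \<subseteq> pverts G" and L_F: "L v \<subseteq> F" for v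
    using in_arcsD2 by (auto simp: L_def F_def)
  then have finF: "finite F" and finL: "finite (L v)" for v
    using pair_finite_verts finite_subset by metis+
  have pos: "c v > 0" if "v \<in> pverts G" for v
    using free_nb[OF that] finL by (auto simp: c_def L_def card_gt_0_iff)
  have "sum c W = card F" if W: "maximal_independent_set G W" for W
  proof -
    have WV: "W \<subseteq> pverts G" and ind: "\<And>u v. u \<in> W \<Longrightarrow> v \<in> W \<Longrightarrow> (u, v) \<notin> parcs G"
      and dom: "\<And>v. v \<in> pverts G \<Longrightarrow> v \<notin> W \<Longrightarrow> \<exists>w\<in>W. (v, w) \<in> parcs G"
      using W by (auto simp: maximal_independent_set_iff independent_set_iff)
    have finW: "finite W"
      using WV pair_finite_verts by (rule finite_subset)
    \<comment> \<open>A free vertex outside \<open>W\<close> has a neighbour in \<open>W\<close>,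
      which is non-free because no two free vertices are adjacent.\<close>
    have F_eq: "F = (W \<inter> F) \<union> (\<Union>v\<in>W - F. L v)"
    proof
      show "F \<subseteq> (W \<inter> F) \<union> (\<Union>v\<in>W - F. L v)"
      proof
        fix x assume x: "x \<in> F"
        show "x \<in> (W \<inter> F) \<union> (\<Union>v\<in>W - F. L v)"
        proof (cases "x \<in> W")
          case False
          then obtain v where "v \<in> W" "(x, v) \<in> parcs G"
            using dom x by (auto simp: F_def)
          with x \<open>\<not> (\<exists>u v. free_vertex G u \<and> free_vertex G v \<and> (u, v) \<in> parcs G)\<close> show ?thesis
            using arcs_symmetric by (auto simp: L_def F_def)
        qed (use x in simp)
      qed
    qed (use L_F in blast)
    \<comment> \<open>A free vertex has a single neighbour, so it is counted only once.\<close>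
    have disj: "L u \<inter> L v = {}" if "u \<noteq> v" for u v
      using that arcs_symmetric by (auto simp: L_def free_vertex_iff)
    have "(W \<inter> F) \<inter> (\<Union>v\<in>W - F. L v) = {}"
      using ind by (auto simp: L_def)
    then have "card F = card (W \<inter> F) + card (\<Union>v\<in>W - F. L v)"
      using finF finW finL by (subst F_eq, subst card_Un_disjoint) auto
    also have "card (\<Union>v\<in>W - F. L v) = (\<Sum>v\<in>W - F. card (L v))"
      using finW finL disj by (intro card_UN_disjoint) auto
    also have "\<dots> = sum c (W - F)"
      using WV by (intro sum.cong) (auto simp: c_def F_def)
    also have "card (W \<inter> F) = sum c (W \<inter> F)"
      by (simp add: c_def F_def)
    also have "sum c (W \<inter> F) + sum c (W - F) = sum c W"
      using sum.Int_Diff[OF finW, of c F] by simp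
    finally show ?thesis ..
  qed
  with pos show ?thesis
    unfolding levelable_def by blast
qed

end

theorem theorem5p4:
  fixes G :: "'a pair_pre_digraph"
  assumes "undirected_tree G"
    and "card (pverts G) \<ge> 2"
  shows "levelable G \<longleftrightarrow>
    (\<forall>v\<in>pverts G. \<not> free_vertex G v \<longrightarrow> (\<exists>w. free_vertex G w \<and> {v, w} \<in> edges G))"
proof -
  interpret undirected_tree_graph G
    using assms(1)
    by (simp add: undirected_tree_def undirected_tree_graph_def undirected_tree_graph_axioms_def)
  show ?thesis
    using levelable_imp_free_neighbour[OF assms(2)] free_neighbours_imp_levelable
    unfolding in_edges_iff by blast
qed

end
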